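(* Let $m,n$ be positive integers and let $\mathbf{r},\mathbf{r}'\in\mathbb{Z}^m$ be integer vectors all of whose entries are congruent to $n$ modulo $2$, such that $\mathbf{r}'\succeq\mathbf{r}$. Then $|A_{\mathbf{r}}(m,n)|\ge|A_{\mathbf{r}'}(m,n)|$.
   Context: A $\pm1$ matrix is one with all entries in $\{1,-1\}$. For an $m\times n$ $\pm1$ matrix $M$, its row-sum vector is $(r_1,\dots,r_m)$ where $r_i$ is the sum of the entries in row $i$. A $\pm1$ matrix is column-good if every column sum lies in $\{-1,0,1\}$. For $\mathbf{r}\in\mathbb{Z}^m$, $A_{\mathbf{r}}(m,n)$ denotes the set of column-good $m\times n$ $\pm1$ matrices with row-sum vector $\mathbf{r}$. For $x,y\in\mathbb{Z}^m$, $x$ majorizes $y$, written $x\succeq y$, if $\sum_{i=1}^m x_i=\sum_{i=1}^m y_i$ and for every $k\in\{1,\dots,m\}$, $\sum_{j=1}^k x_{[j]}\ge\sum_{j=1}^k y_{[j]}$, where $(x_{[1]},\dots,x_{[m]})$ and $(y_{[1]},\dots,y_{[m]})$ are the rearrangements of $x$ and $y$ in nonincreasing order. *)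

theory Defs
  imports "Jordan_Normal_Form.Matrix" "HOL-Number_Theory.Cong"
begin

definition pm1_mat :: "int mat \<Rightarrow> bool" where
  "pm1_mat M \<longleftrightarrow> (\<forall>i < dim_row M. \<forall>j < dim_col M. M $$ (i, j) \<in> {1, -1})"

definition row_sum_vec :: "int mat \<Rightarrow> int vec" where
  "row_sum_vec M = vec (dim_row M) (\<lambda>i. \<Sum>j < dim_col M. M $$ (i, j))"

definition column_good :: "int mat \<Rightarrow> bool" where
  "column_good M \<longleftrightarrow> (\<forall>j < dim_col M. (\<Sum>i < dim_row M. M $$ (i, j)) \<in> {-1, 0, 1})"

definition good_mats :: "int vec \<Rightarrow> nat \<Rightarrow> nat \<Rightarrow> int mat set" where
  "good_mats r m n =
     {M \<in> carrier_mat m n. pm1_mat M \<and> column_good M \<and> row_sum_vec M = r}"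

definition decreasing :: "int vec \<Rightarrow> int list" where
  "decreasing x = rev (sort (list_of_vec x))"

(* List positions start at 0, so the sum over j < k collects the k largest entries. *)
definition majorizes :: "int vec \<Rightarrow> int vec \<Rightarrow> bool" (infix "\<succeq>" 50) where
  "x \<succeq> y \<longleftrightarrow>
     dim_vec x = dim_vec y \<and>
     (\<Sum>i < dim_vec x. x $ i) = (\<Sum>i < dim_vec y. y $ i) \<and>
     (\<forall>k \<in> {1..dim_vec x}. (\<Sum>j < k. decreasing x ! j) \<ge> (\<Sum>j < k. decreasing y ! j))"

(* Hence card (good_mats r m n) is the true number of such matrices, not a default value. *)
lemma finite_good_mats: "finite (good_mats r m n)"
proof -
  let ?F = "PiE ({..<m} \<times> {..<n}) (\<lambda>_. {1, -1 :: int})"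
  have "good_mats r m n \<subseteq> mat m n ` ?F"
  proof
    fix M assume "M \<in> good_mats r m n"
    then have M: "M \<in> carrier_mat m n" "pm1_mat M" by (auto simp: good_mats_def)
    let ?f = "restrict (\<lambda>ij. M $$ ij) ({..<m} \<times> {..<n})"
    have "?f \<in> ?F" using M by (auto simp: pm1_mat_def)
    moreover have "M = mat m n ?f" using M(1) by (intro eq_matI) auto
    ultimately show "M \<in> mat m n ` ?F" by blast
  qed
  moreover have "finite ?F" by (intro finite_PiE) auto
  ultimately show ?thesis using finite_surj by blast
qed

end

theory Submission
  imports Defs "HOL-Combinatorics.Permutations"
begin

text \<open>Fix two rows of a column-good matrix and record all other rows together with the
  columnwise sums of the two rows. If the two rows are opposite in \<open>k\<close> columns, the matrices with
  the same record and prescribed row sums correspond to the \<open>p\<close>-subsets of a \<open>k\<close>-set, where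
  \<open>4 p - 2 k\<close> is the difference of the two row sums. Since binomial coefficients are unimodal,
  moving two units from a larger to a smaller row sum does not decrease the count. Majorization
  is generated by such transfers and permutations, and the count is invariant under permutations
  of the rows.\<close>

section \<open>Transfers between two rows\<close>

lemma card_le_if_fibres_le:
  assumes "finite A" "finite B"
    and "\<And>a. a \<in> A \<Longrightarrow> card {x \<in> A. f x = f a} \<le> card {x \<in> B. f x = f a}"
  shows "card A \<le> card B"
proof -
  have "card A = (\<Sum>z\<in>f ` A. card {x \<in> A. f x = z})"
    using sum.image_gen[OF assms(1), of "\<lambda>_. 1::nat" f] by simp
  also have "\<dots> \<le> (\<Sum>z\<in>f ` A. card {x \<in> B. f x = z})"
    using assms(3) by (intro sum_mono) auto
  also have "\<dots> = card (\<Union>z\<in>f ` A. {x \<in> B. f x = z})"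
    using assms by (intro card_UN_disjoint[symmetric]) auto
  also have "\<dots> \<le> card B"
    using assms by (intro card_mono) auto
  finally show ?thesis .
qed

text \<open>The record of a matrix: the columnwise sum overwrites both rows, so the shape is kept.
  For a pm1 matrix a sum of 2 or -2 determines both entries, while a sum of 0 leaves two
  choices.\<close>

definition merge_rows :: "nat \<Rightarrow> nat \<Rightarrow> int mat \<Rightarrow> int mat" where
  "merge_rows i j M = mat (dim_row M) (dim_col M)
     (\<lambda>(a, c). if a = i \<or> a = j then M $$ (i, c) + M $$ (j, c) else M $$ (a, c))"

text \<open>Stated through the sum rather than through the two entries, so that matrices with equal
  records visibly have the same opposite columns.\<close>

definition opposite_cols :: "nat \<Rightarrow> nat \<Rightarrow> int mat \<Rightarrow> nat set" where
  "opposite_cols i j M = {c. c < dim_col M \<and> M $$ (i, c) + M $$ (j, c) = 0}"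

lemma merge_rows_eqD:
  assumes "merge_rows i j M = merge_rows i j N"
    and "M \<in> carrier_mat m n" "N \<in> carrier_mat m n" "i < m" "c < n"
  shows "M $$ (i, c) + M $$ (j, c) = N $$ (i, c) + N $$ (j, c)"
    and "\<And>a. \<lbrakk>a < m; a \<noteq> i; a \<noteq> j\<rbrakk> \<Longrightarrow> M $$ (a, c) = N $$ (a, c)"
proof -
  have eq: "merge_rows i j M $$ (a, c) = merge_rows i j N $$ (a, c)" for a
    using assms(1) by simp
  show "M $$ (i, c) + M $$ (j, c) = N $$ (i, c) + N $$ (j, c)"
    using eq[of i] assms by (simp add: merge_rows_def)
  show "M $$ (a, c) = N $$ (a, c)" if "a < m" "a \<noteq> i" "a \<noteq> j" for a
    using eq[of a] assms that by (simp add: merge_rows_def)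
qed

lemma sum_remove2:
  fixes f :: "nat \<Rightarrow> int"
  assumes "i < m" "j < m" "i \<noteq> j"
  shows "(\<Sum>a<m. f a) = f i + f j + (\<Sum>a\<in>{..<m} - {i, j}. f a)"
proof -
  have "(\<Sum>a<m. f a) = (\<Sum>a\<in>{i, j}. f a) + (\<Sum>a\<in>{..<m} - {i, j}. f a)"
    using assms by (subst sum.subset_diff[of "{i, j}"]) auto
  with assms show ?thesis by simp
qed

text \<open>Columns in which the two rows agree contribute 0; an opposite column contributes 2 or -2
  according to its entry in row \<open>i\<close>. With p entries 1 among k opposite columns this
  gives 2p - 2(k - p).\<close>

lemma row_sum_diff:
  assumes "M \<in> carrier_mat m n" "pm1_mat M" "i < m" "j < m"
  shows "(\<Sum>c<n. M $$ (i, c)) - (\<Sum>c<n. M $$ (j, c)) =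
    4 * int (card {c \<in> opposite_cols i j M. M $$ (i, c) = 1}) - 2 * int (card (opposite_cols i j M))"
proof -
  let ?K = "opposite_cols i j M" and ?S = "{c \<in> opposite_cols i j M. M $$ (i, c) = 1}"
  have K: "?K \<subseteq> {..<n}" using assms by (auto simp: opposite_cols_def)
  have pm: "M $$ (a, c) = 1 \<or> M $$ (a, c) = -1" if "a < m" "c < n" for a c
    using assms that by (auto simp: pm1_mat_def)
  have "(\<Sum>c<n. M $$ (i, c)) - (\<Sum>c<n. M $$ (j, c)) =
      (\<Sum>c<n. 4 * of_bool (c \<in> ?S) - 2 * of_bool (c \<in> ?K))"
    unfolding sum_subtractf[symmetric]
  proof (rule sum.cong[OF refl])
    fix c assume "c \<in> {..<n}"
    then show "M $$ (i, c) - M $$ (j, c) = 4 * of_bool (c \<in> ?S) - 2 * of_bool (c \<in> ?K)"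
      using pm[of i c] pm[of j c] assms by (auto simp: opposite_cols_def)
  qed
  also have "\<dots> = 4 * (\<Sum>c<n. of_bool (c \<in> ?S)) - 2 * (\<Sum>c<n. of_bool (c \<in> ?K))"
    by (simp add: sum_subtractf sum_distrib_left)
  also have "(\<Sum>c<n. of_bool (c \<in> ?S)) = int (card ?S)"
    using K by (subst sum_of_bool_eq) (auto intro!: arg_cong[where f = card])
  also have "(\<Sum>c<n. of_bool (c \<in> ?K)) = int (card ?K)"
    using K by (subst sum_of_bool_eq) (auto intro!: arg_cong[where f = card])
  finally show ?thesis .
qed

text \<open>The record fixes all column sums, all other rows and the total of the two rows, so only
  the difference of the two row sums remains to be checked. Leaving \<open>y\<close> general covers
  both \<open>x\<close> itself and the vector after a transfer.\<close>

lemma good_mats_fibre_iff: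
  assumes M0: "M0 \<in> good_mats x m n" and M: "M \<in> carrier_mat m n" "pm1_mat M"
    and eq: "merge_rows i j M = merge_rows i j M0"
    and ij: "i < m" "j < m" "i \<noteq> j"
    and y: "y \<in> carrier_vec m" "y $ i + y $ j = x $ i + x $ j"
      "\<And>a. \<lbrakk>a < m; a \<noteq> i; a \<noteq> j\<rbrakk> \<Longrightarrow> y $ a = x $ a"
  shows "M \<in> good_mats y m n \<longleftrightarrow> 4 * int (card {c \<in> opposite_cols i j M0. M $$ (i, c) = 1})
    - 2 * int (card (opposite_cols i j M0)) = y $ i - y $ j"
proof -
  have M0c: "M0 \<in> carrier_mat m n" and x: "row_sum_vec M0 = x" and good: "column_good M0"
    using M0 by (auto simp: good_mats_def)
  note eqD = merge_rows_eqD[OF eq M(1) M0c ij(1)]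
  have row0: "(\<Sum>c<n. M0 $$ (a, c)) = x $ a" if "a < m" for a
    using M0c that x[symmetric] by (simp add: row_sum_vec_def)
  have rowo: "(\<Sum>c<n. M $$ (a, c)) = y $ a" if "a < m" "a \<noteq> i" "a \<noteq> j" for a
    using row0[OF that(1)] y(3)[OF that] eqD(2)[OF _ that] by simp
  have rowij: "(\<Sum>c<n. M $$ (i, c)) + (\<Sum>c<n. M $$ (j, c)) = y $ i + y $ j"
    unfolding y(2) row0[OF ij(1), symmetric] row0[OF ij(2), symmetric] sum.distrib[symmetric]
    using eqD(1) by (intro sum.cong) auto
  have "(\<Sum>a<m. M $$ (a, c)) = (\<Sum>a<m. M0 $$ (a, c))" if "c < n" for c
    using eqD[OF that] by (simp add: sum_remove2[OF ij])
  then have "column_good M"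
    using good M(1) M0c by (simp add: column_good_def)
  then have "M \<in> good_mats y m n \<longleftrightarrow> row_sum_vec M = y"
    using M by (simp add: good_mats_def)
  also have "\<dots> \<longleftrightarrow> (\<forall>a<m. (\<Sum>c<n. M $$ (a, c)) = y $ a)"
    using M(1) y(1) by (auto simp: row_sum_vec_def vec_eq_iff)
  also have "\<dots> \<longleftrightarrow> (\<Sum>c<n. M $$ (i, c)) = y $ i \<and> (\<Sum>c<n. M $$ (j, c)) = y $ j"
    using rowo ij by blast
  \<comment> \<open>The sum of the two row sums is already known, so their difference determines
    both.\<close>
  also have "\<dots> \<longleftrightarrow> (\<Sum>c<n. M $$ (i, c)) - (\<Sum>c<n. M $$ (j, c)) = y $ i - y $ j"
    using rowij by linarith
  also have "opposite_cols i j M = opposite_cols i j M0"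
    using eqD(1) M(1) M0c by (auto simp: opposite_cols_def)
  then have "(\<Sum>c<n. M $$ (i, c)) - (\<Sum>c<n. M $$ (j, c)) = y $ i - y $ j \<longleftrightarrow>
    4 * int (card {c \<in> opposite_cols i j M0. M $$ (i, c) = 1})
    - 2 * int (card (opposite_cols i j M0)) = y $ i - y $ j"
    using row_sum_diff[OF M ij(1,2)] by simp
  finally show ?thesis .
qed

text \<open>A member of the fibre is determined by the opposite columns in which row
  \<open>i\<close> carries 1, and the row sums restrict this set only through its size
  \<open>p\<close>.\<close>

lemma card_good_mats_fibre:
  assumes M0: "M0 \<in> good_mats x m n"
    and ij: "i < m" "j < m" "i \<noteq> j"
    and y: "y \<in> carrier_vec m" "y $ i + y $ j = x $ i + x $ j"
      "\<And>a. \<lbrakk>a < m; a \<noteq> i; a \<noteq> j\<rbrakk> \<Longrightarrow> y $ a = x $ a"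
    and p: "4 * int p - 2 * int (card (opposite_cols i j M0)) = y $ i - y $ j"
  shows "card {M \<in> good_mats y m n. merge_rows i j M = merge_rows i j M0} =
    card (opposite_cols i j M0) choose p"
proof -
  let ?K = "opposite_cols i j M0"
  let ?A = "{S. S \<subseteq> ?K \<and> card S = p}"
  let ?B = "{M \<in> good_mats y m n. merge_rows i j M = merge_rows i j M0}"
  \<comment> \<open>In the opposite columns \<open>S\<close> marks where row \<open>i\<close> gets 1
    and row \<open>j\<close> gets -1, with the signs swapped off \<open>S\<close>; everything else
    is copied from \<open>M0\<close>.\<close>
  let ?to = "\<lambda>S. mat m n (\<lambda>(a, c).
     if c \<in> ?K \<and> a = i then if c \<in> S then 1 else -1
     else if c \<in> ?K \<and> a = j then if c \<in> S then -1 else 1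
     else M0 $$ (a, c))"
  let ?fro = "\<lambda>M. {c \<in> ?K. M $$ (i, c) = 1}"
  have M0c: "M0 \<in> carrier_mat m n" and pm0: "pm1_mat M0"
    using M0 by (auto simp: good_mats_def)
  have Kn: "c < n" if "c \<in> ?K" for c
    using that M0c by (auto simp: opposite_cols_def)
  have fro_to: "?fro (?to S) = S" if "S \<subseteq> ?K" for S
    using that Kn ij by (auto split: if_splits)
  have pm_to: "pm1_mat (?to S)" for S
    using pm0 M0c by (auto simp: pm1_mat_def)
  have merge_to: "merge_rows i j (?to S) = merge_rows i j M0" for S
    using M0c ij by (intro eq_matI) (auto simp: merge_rows_def opposite_cols_def)
  have "bij_betw ?to ?A ?B"
  proof (rule bij_betw_byWitness[where f' = ?fro])
    show "\<forall>S\<in>?A. ?fro (?to S) = S" using fro_to by blast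
    show "\<forall>M\<in>?B. ?to (?fro M) = M"
    proof
      fix M assume "M \<in> ?B"
      then have M: "M \<in> carrier_mat m n" "pm1_mat M" "merge_rows i j M = merge_rows i j M0"
        by (auto simp: good_mats_def)
      note eqD = merge_rows_eqD[OF M(3,1) M0c ij(1)]
      have pm: "N $$ (a, c) = 1 \<or> N $$ (a, c) = -1" if "N = M \<or> N = M0" "a < m" "c < n" for N a c
        using M pm0 M0c that by (auto simp: pm1_mat_def)
      show "?to (?fro M) = M"
      proof (rule eq_matI)
        fix a c assume "a < dim_row M" "c < dim_col M"
        then have ac: "a < m" "c < n" using M by auto
        \<comment> \<open>Outside \<open>?K\<close> the column sum 2 or -2 forces the entries of
          \<open>M\<close> and \<open>M0\<close> to agree; inside \<open>?K\<close> the entry in row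
          \<open>j\<close> is the negative of that in row \<open>i\<close>.\<close>
        show "?to (?fro M) $$ (a, c) = M $$ (a, c)"
          using ac eqD(1)[OF ac(2)] eqD(2)[OF ac(2) ac(1)]
            pm[of M i c] pm[of M j c] pm[of M0 i c] pm[of M0 j c] ij M0c
          by (cases "a = i"; cases "a = j") (auto simp: opposite_cols_def)
      qed (use M in auto)
    qed
    show "?to ` ?A \<subseteq> ?B"
    proof
      fix M assume "M \<in> ?to ` ?A"
      then obtain S where S: "S \<subseteq> ?K" "card S = p" "M = ?to S" by auto
      have "?to S \<in> good_mats y m n"
        by (subst good_mats_fibre_iff[OF M0 _ pm_to merge_to ij y])
          (use p S fro_to[OF S(1)] in auto)
      with S merge_to show "M \<in> ?B" by auto
    qed
    show "?fro ` ?B \<subseteq> ?A"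
    proof safe
      fix M assume M: "M \<in> good_mats y m n" "merge_rows i j M = merge_rows i j M0"
      then have "M \<in> carrier_mat m n" "pm1_mat M" by (auto simp: good_mats_def)
      from good_mats_fibre_iff[OF M0 this M(2) ij y] M(1) p show "card (?fro M) = p" by simp
    qed
  qed
  then have "card ?B = card ?A" by (simp add: bij_betw_same_card)
  also have "\<dots> = card ?K choose p"
    by (rule n_subsets) (simp add: opposite_cols_def)
  finally show ?thesis .
qed

text \<open>The transfer lowers the difference of the two row sums by 4, hence turns
  \<open>k choose p\<close> into \<open>k choose (p - 1)\<close> on each fibre.\<close>

lemma card_good_mats_transfer:
  assumes x: "x \<in> carrier_vec m" and ij: "i < m" "j < m" "i \<noteq> j" and gt: "x $ i > x $ j"
  shows "card (good_mats x m n) \<le>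
    card (good_mats (vec m (\<lambda>a. if a = i then x $ i - 2 else if a = j then x $ j + 2 else x $ a)) m n)"
    (is "_ \<le> card (good_mats ?y m n)")
proof (rule card_le_if_fibres_le[OF finite_good_mats finite_good_mats, where f = "merge_rows i j"])
  fix M0 assume M0: "M0 \<in> good_mats x m n"
  define k where "k = card (opposite_cols i j M0)"
  define p where "p = card {c \<in> opposite_cols i j M0. M0 $$ (i, c) = 1}"
  have p: "4 * int p - 2 * int k = x $ i - x $ j"
    using good_mats_fibre_iff[OF M0 _ _ refl ij x] M0
    unfolding k_def p_def by (simp add: good_mats_def)
  with gt have p0: "p > 0" "k < 2 * p" by linarith+
  have "p \<le> k"
    unfolding k_def p_def by (intro card_mono) (auto simp: opposite_cols_def)
  have "card {M \<in> good_mats x m n. merge_rows i j M = merge_rows i j M0} = k choose p"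
    unfolding k_def by (rule card_good_mats_fibre[OF M0 ij x]) (use p k_def in auto)
  \<comment> \<open>From \<open>k < 2 * p\<close> follows \<open>k div 2 \<le> p - 1\<close>, so
    both indices lie in the range where binomial coefficients do not increase.\<close>
  also have "\<dots> \<le> k choose (p - 1)"
    using p0 \<open>p \<le> k\<close> by (intro binomial_antimono) auto
  also have "\<dots> = card {M \<in> good_mats ?y m n. merge_rows i j M = merge_rows i j M0}"
    unfolding k_def
    by (rule card_good_mats_fibre[OF M0 ij, symmetric]) (use p k_def p0 ij in auto)
  finally show "card {M \<in> good_mats x m n. merge_rows i j M = merge_rows i j M0} \<le>
    card {M \<in> good_mats ?y m n. merge_rows i j M = merge_rows i j M0}" .
qed

section \<open>From transfers to majorization\<close>

text \<open>Induction on the l1 distance of \<open>x\<close> and \<open>y\<close>: two units move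
  from an earlier surplus to the first deficit. Since \<open>x\<close> may be unsorted, the vector
  after a transfer is admissible as it stands.\<close>

lemma card_good_mats_prefix_dominance:
  assumes "x \<in> carrier_vec m" "y \<in> carrier_vec m"
    and "\<And>i j. \<lbrakk>i \<le> j; j < m\<rbrakk> \<Longrightarrow> y $ j \<le> y $ i"
    and "\<And>i. i < m \<Longrightarrow> even (x $ i - y $ i)"
    and "\<And>k. k \<le> m \<Longrightarrow> (\<Sum>i<k. y $ i) \<le> (\<Sum>i<k. x $ i)"
    and "(\<Sum>i<m. x $ i) = (\<Sum>i<m. y $ i)"
  shows "card (good_mats x m n) \<le> card (good_mats y m n)"
  using assms
proof (induction "nat (\<Sum>i<m. \<bar>x $ i - y $ i\<bar>)" arbitrary: x rule: less_induct)
  case less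
  note y = less.prems(2,3)
  show ?case
  proof (cases "\<exists>j<m. x $ j < y $ j")
    case False
    \<comment> \<open>Without deficits the differences are nonnegative, and they sum to 0.\<close>
    then have "\<forall>i\<in>{..<m}. x $ i - y $ i = 0"
      using less.prems(6)
      by (subst sum_nonneg_eq_0_iff[symmetric]) (force simp: sum_subtractf)+
    then have "x = y"
      using less.prems(1,2) by (intro eq_vecI) auto
    then show ?thesis by simp
  next
    case True
    define j where "j = (LEAST j. j < m \<and> x $ j < y $ j)"
    have j: "j < m" "x $ j < y $ j"
      using LeastI_ex[of "\<lambda>j. j < m \<and> x $ j < y $ j"] True by (auto simp: j_def)
    have before: "y $ a \<le> x $ a" if "a < j" for a
      using not_less_Least[of a "\<lambda>j. j < m \<and> x $ j < y $ j"] that j(1) by (auto simp: j_def)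
    \<comment> \<open>Otherwise the deficit at \<open>j\<close> would violate dominance of the
      prefix of length \<open>Suc j\<close>.\<close>
    have "\<exists>i<j. y $ i < x $ i"
    proof (rule ccontr)
      assume "\<not> ?thesis"
      then have "(\<Sum>i<j. x $ i) \<le> (\<Sum>i<j. y $ i)" by (intro sum_mono) auto
      with less.prems(5)[of "Suc j"] j show False by simp
    qed
    then obtain i where i: "i < j" "y $ i < x $ i" by blast
    have ij: "i < m" "j < m" "i \<noteq> j" using i j by auto
    \<comment> \<open>By parity the surplus and the deficit are at least 2, so moving two units
      overshoots neither.\<close>
    have xi: "x $ i \<ge> y $ i + 2" using less.prems(4)[of i] i ij by presburger
    have xj: "x $ j + 2 \<le> y $ j" using less.prems(4)[of j] j by presburger
    \<comment> \<open>This completes the chain \<open>x $ j < y $ j \<le> y $ i < x $ i\<close>,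
      which makes the transfer applicable.\<close>
    have yij: "y $ j \<le> y $ i" using y(2)[of i j] i j by simp
    define z where "z = vec m (\<lambda>a. if a = i then x $ i - 2 else if a = j then x $ j + 2 else x $ a)"
    have z_carrier: "z \<in> carrier_vec m" by (simp add: z_def)
    have z: "z $ a = x $ a - 2 * of_bool (a = i) + 2 * of_bool (a = j)" if "a < m" for a
      using that ij by (auto simp: z_def)
    have z_sum: "(\<Sum>a<k. z $ a) = (\<Sum>a<k. x $ a) - 2 * of_bool (i < k) + 2 * of_bool (j < k)"
      if "k \<le> m" for k
    proof -
      have "(\<Sum>a<k. z $ a) = (\<Sum>a<k. x $ a - 2 * of_bool (a = i) + 2 * of_bool (a = j))"
        using that z by (intro sum.cong) auto
      also have "\<dots> = (\<Sum>a<k. x $ a) - 2 * (\<Sum>a<k. of_bool (a = i)) + 2 * (\<Sum>a<k. of_bool (a = j))"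
        by (simp add: sum.distrib sum_subtractf sum_distrib_left)
      finally show ?thesis by (simp add: of_bool_def)
    qed
    have "(\<Sum>a<m. \<bar>z $ a - y $ a\<bar>) < (\<Sum>a<m. \<bar>x $ a - y $ a\<bar>)"
      using z xi xj ij by (intro sum_strict_mono_ex1) (auto intro!: bexI[of _ i])
    then have "nat (\<Sum>a<m. \<bar>z $ a - y $ a\<bar>) < nat (\<Sum>a<m. \<bar>x $ a - y $ a\<bar>)"
      by (smt (verit) nat_mono_iff sum_nonneg abs_ge_zero)
    moreover have "even (z $ a - y $ a)" if "a < m" for a
      using less.prems(4)[OF that] z[OF that] by simp
    moreover have "(\<Sum>a<k. y $ a) \<le> (\<Sum>a<k. z $ a)" if k: "k \<le> m" for k
    \<comment> \<open>Only prefixes containing \<open>i\<close> but not \<open>j\<close> lose 2.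
      There every entry of \<open>x\<close> is at least that of \<open>y\<close>, and the surplus at
      \<open>i\<close> pays for the loss.\<close>
    proof (cases "i < k \<and> \<not> j < k")
      case True
      have "(\<Sum>a<k. y $ a + 2 * of_bool (a = i)) \<le> (\<Sum>a<k. x $ a)"
        using before xi True by (intro sum_mono) auto
      moreover have "(\<Sum>a<k. y $ a + 2 * of_bool (a = i)) = (\<Sum>a<k. y $ a) + 2"
        using True by (simp add: sum.distrib sum_distrib_left[symmetric] of_bool_def)
      ultimately show ?thesis using z_sum[OF k] True by simp
    next
      case False
      then show ?thesis using z_sum[OF k] less.prems(5)[OF k] i by auto
    qed
    moreover have "(\<Sum>a<m. z $ a) = (\<Sum>a<m. y $ a)"
      using z_sum[of m] less.prems(6) ij by simp
    ultimately have "card (good_mats z m n) \<le> card (good_mats y m n)"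
      using less.hyps z_carrier y by blast
    moreover have "card (good_mats x m n) \<le> card (good_mats z m n)"
      unfolding z_def by (rule card_good_mats_transfer) (use less.prems(1) ij xi xj yij in auto)
    ultimately show ?thesis by simp
  qed
qed

section \<open>Row permutations and sorting\<close>

lemma card_good_mats_permute_le:
  assumes p: "p permutes {..<m}" and x: "x \<in> carrier_vec m"
  shows "card (good_mats x m n) \<le> card (good_mats (vec m (\<lambda>i. x $ p i)) m n)"
proof (rule card_inj_on_le[OF _ _ finite_good_mats])
  let ?f = "\<lambda>M. mat m n (\<lambda>(i, j). M $$ (p i, j)) :: int mat"
  have pm: "p i < m \<longleftrightarrow> i < m" for i
    using permutes_in_image[OF p, of i] by simp
  show "inj_on ?f (good_mats x m n)"
  proof (rule inj_onI)
    fix M N assume MN: "M \<in> good_mats x m n" "N \<in> good_mats x m n" and eq: "?f M = ?f N"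
    then have c: "M \<in> carrier_mat m n" "N \<in> carrier_mat m n" by (auto simp: good_mats_def)
    show "M = N"
    proof (rule eq_matI)
      fix i j assume "i < dim_row N" "j < dim_col N"
      then have ij: "i < m" "j < n" using c by auto
      \<comment> \<open>Row \<open>i\<close> of the original matrix reappears as row
        \<open>inv_into UNIV p i\<close> of the image, which gives injectivity.\<close>
      have *: "p (inv_into UNIV p i) = i" using permutes_inverses[OF p] by simp
      then have "inv_into UNIV p i < m" using pm[of "inv_into UNIV p i"] ij by simp
      then show "M $$ (i, j) = N $$ (i, j)"
        using arg_cong[OF eq, of "\<lambda>A. A $$ (inv_into UNIV p i, j)"] ij * by simp
    qed (use c in auto)
  qed
  show "?f ` good_mats x m n \<subseteq> good_mats (vec m (\<lambda>i. x $ p i)) m n"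
  proof safe
    fix M assume M: "M \<in> good_mats x m n"
    then have c: "M \<in> carrier_mat m n" by (auto simp: good_mats_def)
    have "(\<Sum>i<m. M $$ (p i, j)) = (\<Sum>i<m. M $$ (i, j))" for j
      using sum.permute[OF p, of "\<lambda>i. M $$ (i, j)"] by (simp add: o_def)
    then show "?f M \<in> good_mats (vec m (\<lambda>i. x $ p i)) m n"
      using M c pm x
      by (auto simp: good_mats_def pm1_mat_def column_good_def row_sum_vec_def vec_eq_iff)
  qed
qed

text \<open>The reverse inequality is the preceding one applied to the inverse permutation.\<close>

lemma card_good_mats_permute:
  assumes p: "p permutes {..<m}" and x: "x \<in> carrier_vec m"
  shows "card (good_mats (vec m (\<lambda>i. x $ p i)) m n) = card (good_mats x m n)"
proof (rule antisym)
  let ?y = "vec m (\<lambda>i. x $ p i)"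
  have "vec m (\<lambda>i. ?y $ inv_into UNIV p i) = x"
  proof (rule eq_vecI)
    fix i assume "i < dim_vec x"
    then have "i < m" using x by simp
    moreover then have "inv_into UNIV p i < m"
      using permutes_in_image[OF permutes_inv[OF p], of i] by simp
    ultimately show "vec m (\<lambda>i. ?y $ inv_into UNIV p i) $ i = x $ i"
      using permutes_inverses(1)[OF p] by simp
  qed (use x in simp)
  then show "card (good_mats ?y m n) \<le> card (good_mats x m n)"
    using card_good_mats_permute_le[OF permutes_inv[OF p], of ?y n] by simp
qed (rule card_good_mats_permute_le[OF p x])

text \<open>Lets the sorted prefix sums in \<open>majorizes\<close> be read as prefix sums of a
  vector with permuted entries, whose matrices have the same count.\<close>

lemma decreasing_permutation:
  assumes x: "x \<in> carrier_vec m"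
  obtains p where "p permutes {..<m}" "\<And>i. i < m \<Longrightarrow> decreasing x ! i = x $ p i"
proof -
  have len: "length (list_of_vec x) = m" using x by simp
  have "mset (decreasing x) = mset (list_of_vec x)" by (simp add: decreasing_def)
  then obtain p where p: "p permutes {..<m}" "permute_list p (list_of_vec x) = decreasing x"
    using mset_eq_permutation len by metis
  have "decreasing x ! i = x $ p i" if "i < m" for i
    using that p len permutes_in_image[OF p(1), of i] x
    by (simp add: p(2)[symmetric] permute_list_nth list_of_vec_index)
  with p that show ?thesis by blast
qed

lemma decreasing_antimono:
  assumes "x \<in> carrier_vec m" "i \<le> j" "j < m"
  shows "decreasing x ! j \<le> decreasing x ! i"
proof -
  have "sorted (rev (decreasing x))" and "length (decreasing x) = m"
    using assms by (simp_all add: decreasing_def)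
  then show ?thesis using assms by (auto intro: sorted_rev_nth_mono)
qed

theorem theorem6:
  fixes m n :: nat and r r' :: "int vec"
  assumes "m > 0" and "n > 0"
    and "r \<in> carrier_vec m" and "r' \<in> carrier_vec m"
    and "\<And>i. i < m \<Longrightarrow> [r $ i = int n] (mod 2)"
    and "\<And>i. i < m \<Longrightarrow> [r' $ i = int n] (mod 2)"
    and "r' \<succeq> r"
  shows "card (good_mats r m n) \<ge> card (good_mats r' m n)"
proof -
  note carr = assms(3,4)
  obtain p where p: "p permutes {..<m}" "\<And>i. i < m \<Longrightarrow> decreasing r ! i = r $ p i"
    using decreasing_permutation[OF carr(1)] by blast
  obtain q where q: "q permutes {..<m}" "\<And>i. i < m \<Longrightarrow> decreasing r' ! i = r' $ q i"
    using decreasing_permutation[OF carr(2)] by blast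
  let ?y = "vec m (\<lambda>i. r $ p i)" and ?x = "vec m (\<lambda>i. r' $ q i)"
  \<comment> \<open>For the sorted rearrangements, majorization is exactly prefix dominance with
    equal totals.\<close>
  have "card (good_mats ?x m n) \<le> card (good_mats ?y m n)"
  proof (rule card_good_mats_prefix_dominance)
    show "?y $ j \<le> ?y $ i" if "i \<le> j" "j < m" for i j
      using decreasing_antimono[OF carr(1) that] p(2) that by simp
    show "even (?x $ i - ?y $ i)" if "i < m" for i
    proof -
      \<comment> \<open>All entries share the parity of \<open>n\<close>, so sorting the two vectors
        by different permutations is harmless.\<close>
      have "[r' $ q i = r $ p i] (mod 2)"
        using assms(5)[of "p i"] assms(6)[of "q i"] that
          permutes_in_image[OF p(1), of i] permutes_in_image[OF q(1), of i]
        by (auto intro: cong_trans cong_sym)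
      then show ?thesis using that by (simp add: cong_iff_dvd_diff)
    qed
    show "(\<Sum>i<k. ?y $ i) \<le> (\<Sum>i<k. ?x $ i)" if "k \<le> m" for k
    \<comment> \<open>\<open>majorizes\<close> speaks of prefixes of length at least 1; the empty
      prefix is trivial.\<close>
    proof (cases "k = 0")
      case False
      then have "(\<Sum>i<k. decreasing r ! i) \<le> (\<Sum>i<k. decreasing r' ! i)"
        using assms(7) carr that by (auto simp: majorizes_def)
      moreover have "(\<Sum>i<k. ?y $ i) = (\<Sum>i<k. decreasing r ! i)"
        using p(2) that by (intro sum.cong) auto
      moreover have "(\<Sum>i<k. ?x $ i) = (\<Sum>i<k. decreasing r' ! i)"
        using q(2) that by (intro sum.cong) auto
      ultimately show ?thesis by simp
    qed simp
    have "(\<Sum>i<m. ?x $ i) = (\<Sum>i<m. r' $ i)"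
      using sum.permute[OF q(1), of "($) r'"] by (simp add: o_def)
    also have "\<dots> = (\<Sum>i<m. r $ i)"
      using assms(7) carr by (simp add: majorizes_def)
    also have "\<dots> = (\<Sum>i<m. ?y $ i)"
      using sum.permute[OF p(1), of "($) r"] by (simp add: o_def)
    finally show "(\<Sum>i<m. ?x $ i) = (\<Sum>i<m. ?y $ i)" .
  qed simp_all
  then show ?thesis
    using card_good_mats_permute[OF p(1) carr(1)] card_good_mats_permute[OF q(1) carr(2)] by simp
qed

end
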